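(* Let $A$ be a loop which satisfies $$(ab)/(a'b)=(ab')/(a'b')$$ for all $a,a',b,b'\in A$ (i.e. $A$ is right-cancellable with respect to the protomodular terms $\theta(a,b)=ab$ and $\alpha(a,b)=a/b$). Then $A$ is a group.
   Context: A loop is a set with a binary operation $(a,b)\mapsto ab$ having a two-sided unit $e$ such that for all $a,b$ the equations $xb=a$ and $bx=a$ have unique solutions; $a/b$ denotes the unique $x$ with $xb=a$. "Is a group" means that the loop multiplication is a group operation. *)

theory Defs
  imports "HOL-Algebra.Group"
begin

(* Loops reuse the monoid record, which only bundles a carrier, a multiplication and a
   distinguished element; the unit e is the field one. Associativity is not assumed. *)
locale loop =
  fixes A :: "('a, 'b) monoid_scheme" (structure)
  assumes mult_closed: "\<lbrakk>a \<in> carrier A; b \<in> carrier A\<rbrakk> \<Longrightarrow> a \<otimes> b \<in> carrier A"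
    and unit_closed: "\<one> \<in> carrier A"
    and unit_left: "a \<in> carrier A \<Longrightarrow> \<one> \<otimes> a = a"
    and unit_right: "a \<in> carrier A \<Longrightarrow> a \<otimes> \<one> = a"
    and right_div_unique: "\<lbrakk>a \<in> carrier A; b \<in> carrier A\<rbrakk> \<Longrightarrow> \<exists>!x. x \<in> carrier A \<and> x \<otimes> b = a"
    and left_div_unique: "\<lbrakk>a \<in> carrier A; b \<in> carrier A\<rbrakk> \<Longrightarrow> \<exists>!x. x \<in> carrier A \<and> b \<otimes> x = a"

definition rdiv :: "('a, 'b) monoid_scheme \<Rightarrow> 'a \<Rightarrow> 'a \<Rightarrow> 'a"  (infixl "\<oslash>\<index>" 70)
  where "a \<oslash>\<^bsub>A\<^esub> b = (THE x. x \<in> carrier A \<and> x \<otimes>\<^bsub>A\<^esub> b = a)"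

end

theory Submission
  imports Defs
begin

text \<open>
  Taking \<open>b' = \<one>\<close>, the identity says that right quotients survive multiplication on the right:
  \<open>(a b) / (a' b) = a / a'\<close>. For \<open>a = x y\<close> and \<open>a' = y\<close> the right-hand side is \<open>x\<close>, so that
  \<open>((x y) z) / (y z) = x\<close>. Multiplying by \<open>y z\<close> gives the associative law, and a loop with an
  associative multiplication is a group because division provides inverses.
\<close>

context loop
begin

lemma rdiv_mult_cancel:
  assumes "a \<in> carrier A" "b \<in> carrier A"
  shows "(a \<oslash> b) \<otimes> b = a"
  unfolding rdiv_def using theI'[OF right_div_unique[OF assms]] by blast

lemma mult_rdiv_cancel:
  assumes "x \<in> carrier A" "b \<in> carrier A"
  shows "(x \<otimes> b) \<oslash> b = x"
  unfolding rdiv_def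
  using right_div_unique[OF mult_closed[OF assms] assms(2)] assms by (intro the1_equality) auto

lemma group_if_assoc:
  assumes "\<And>x y z. \<lbrakk>x \<in> carrier A; y \<in> carrier A; z \<in> carrier A\<rbrakk>
    \<Longrightarrow> (x \<otimes> y) \<otimes> z = x \<otimes> (y \<otimes> z)"
  shows "group A"
proof (rule groupI)
  fix x assume "x \<in> carrier A"
  then show "\<exists>y\<in>carrier A. y \<otimes> x = \<one>"
    using right_div_unique[OF unit_closed] by blast
qed (simp_all add: mult_closed unit_closed unit_left assms)

end

theorem proposition3p6:
  fixes A :: "('a, 'b) monoid_scheme" (structure)
  assumes "loop A"
    and "\<forall>a\<in>carrier A. \<forall>a'\<in>carrier A. \<forall>b\<in>carrier A. \<forall>b'\<in>carrier A.
           (a \<otimes> b) \<oslash> (a' \<otimes> b) = (a \<otimes> b') \<oslash> (a' \<otimes> b')"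
  shows "group A"
proof -
  interpret loop A by (rule assms(1))
  show ?thesis
  proof (rule group_if_assoc)
    fix x y z assume x: "x \<in> carrier A" and y: "y \<in> carrier A" and z: "z \<in> carrier A"
    have xy: "x \<otimes> y \<in> carrier A" and yz: "y \<otimes> z \<in> carrier A"
      and xyz: "(x \<otimes> y) \<otimes> z \<in> carrier A"
      using x y z by (simp_all add: mult_closed)
    have "((x \<otimes> y) \<otimes> z) \<oslash> (y \<otimes> z) = ((x \<otimes> y) \<otimes> \<one>) \<oslash> (y \<otimes> \<one>)"
      using assms(2) xy y z unit_closed by blast
    also have "\<dots> = x"
      using x y xy by (simp add: unit_right mult_rdiv_cancel)
    finally show "(x \<otimes> y) \<otimes> z = x \<otimes> (y \<otimes> z)"
      using rdiv_mult_cancel[OF xyz yz] by simp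
  qed
qed

end
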